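(* Let $n\ge 2$ and $m$ be integers with $2\le m\le n$ and $n-m$ even. Then for every $r\in[0,1]$ the following relationships hold: $$R_n^m(r) = r\left(R_{n-1}^{|m-1|}(r)+R_{n-1}^{m+1}(r)\right)-R_{n-2}^m(r),$$ $$S_n^{m-2}(r)=\frac{1}{n+1}\left(R_{n+1}^{m-1}(r)-R_{n-1}^{m-1}(r)\right)-S_n^m(r),$$ $$Q_n^{m-2}(r)=S_{n+1}^{m-1}(r)+S_{n-1}^{m-1}(r)-Q_n^m(r).$$ In addition, in the case $m=n$, $$R_n^n(r)=r^n,\qquad S_n^n(r)=\frac{r^{n+1}}{n+1},\qquad Q_n^n(r)=\frac{r^{n+2}}{n+2}.$$
   Context: For integers $n\ge 0$ and $m\ge 0$ with $m\le n$ and $n-m$ even, the Zernike radial polynomial is $$R_n^m(r)=\sum_{k=0}^{(n-m)/2}(-1)^k\frac{(n-k)!}{k!\left(\frac{n+m}{2}-k\right)!\left(\frac{n-m}{2}-k\right)!}\,r^{n-2k}.$$ By convention $R_n^m=0$ if $m>n$ (empty sum). Its integrals are $$S_n^m(r)=\int_0^r R_n^m(t)\,dt,\qquad Q_n^m(r)=\int_0^r t\,R_n^m(t)\,dt.$$ *)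

theory Defs
  imports "HOL-Analysis.Analysis"
begin

text \<open>
  The polynomials are indexed by natural numbers \<open>n\<close>, \<open>m\<close> and are meaningful for \<open>n - m\<close> even.
  The guard \<open>m \<le> n\<close> is needed because subtraction on \<^typ>\<open>nat\<close> truncates: for \<open>m > n\<close> the
  index set \<open>{0..(n - m) div 2}\<close> would be \<open>{0}\<close> instead of empty.
\<close>

definition zernike_R :: "nat \<Rightarrow> nat \<Rightarrow> real \<Rightarrow> real" where
  "zernike_R n m r =
     (if m \<le> n then
        (\<Sum>k = 0..(n - m) div 2.
           (- 1) ^ k * (fact (n - k) /
             (fact k * fact ((n + m) div 2 - k) * fact ((n - m) div 2 - k))) * r ^ (n - 2 * k))
      else 0)"

text \<open>The following integrals over \<open>{0..r}\<close> agree with the oriented integral from 0 to \<open>r\<close>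
  only for \<open>r \<ge> 0\<close>.\<close>

definition zernike_S :: "nat \<Rightarrow> nat \<Rightarrow> real \<Rightarrow> real" where
  "zernike_S n m r = integral {0..r} (\<lambda>t. zernike_R n m t)"

definition zernike_Q :: "nat \<Rightarrow> nat \<Rightarrow> real \<Rightarrow> real" where
  "zernike_Q n m r = integral {0..r} (\<lambda>t. t * zernike_R n m t)"

end

theory Submission imports Defs begin

text \<open>
  In the coordinates \<open>n = a + b\<close>, \<open>m = a - b\<close> the coefficients of \<open>R\<^sub>n\<^sup>m\<close> are, up to sign, the
  trinomial coefficients \<open>(i + j + k)! / (i! j! k!)\<close> with \<open>i = a - k\<close> and \<open>j = b - k\<close>. Pascal's
  rule for them is the three-term recurrence of the \<open>R\<close>; weighting it by the exponents gives
  \<open>d/dr (R\<^bsub>n+1\<^esub>\<^bsup>m-1\<^esup> - R\<^bsub>n-1\<^esub>\<^bsup>m-1\<^esup>) = (n + 1) (R\<^sub>n\<^bsup>m-2\<^esup> + R\<^sub>n\<^sup>m)\<close>. Integrating these two identities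
  from \<open>0\<close> yields the relations for \<open>Q\<close> and \<open>S\<close>.
\<close>

text \<open>The value 0 outside k <= min a b stands for the reciprocal factorial of a negative
  integer. With it Pascal's rule also holds at the boundary, and sums over k may be lengthened
  freely.\<close>

definition zcoeff :: "nat \<Rightarrow> nat \<Rightarrow> nat \<Rightarrow> real" where
  "zcoeff a b k =
     (if k \<le> a \<and> k \<le> b then (- 1) ^ k * (fact (a + b - k) / (fact k * fact (a - k) * fact (b - k)))
      else 0)"

definition zpoly :: "nat \<Rightarrow> nat \<Rightarrow> real \<Rightarrow> real" where
  "zpoly a b r = (\<Sum>k\<le>b. zcoeff a b k * r ^ (a + b - 2 * k))"

lemma zernike_R_eq_zpoly:
  assumes "b \<le> a"
  shows "zernike_R (a + b) (a - b) r = zpoly a b r"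
proof -
  have *: "a + b - (a - b) = 2 * b" "a + b + (a - b) = 2 * a" "a - b \<le> a + b"
    using assms by auto
  show ?thesis
    unfolding zernike_R_def zpoly_def *(1,2) using assms
    by (auto simp: zcoeff_def atMost_atLeast0 intro!: sum.cong)
qed

text \<open>Brings polynomials with different second index to a common range of summation.\<close>

lemma zpoly_extend:
  assumes "b \<le> N"
  shows "zpoly a b r = (\<Sum>k\<le>N. zcoeff a b k * r ^ (a + b - 2 * k))"
  unfolding zpoly_def using assms
  by (intro sum.mono_neutral_left) (auto simp: zcoeff_def)

lemma zpoly_0_right [simp]: "zpoly a 0 r = r ^ a"
  by (simp add: zpoly_def zcoeff_def)

text \<open>All exponents are at least a - b > 0.\<close>

lemma zpoly_at_0:
  assumes "b < a"
  shows "zpoly a b 0 = 0"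
  using assms by (auto simp: zpoly_def zcoeff_def intro!: sum.neutral)

lemma zcoeff_0 [simp]: "zcoeff a b 0 = fact (a + b) / (fact a * fact b)"
  by (simp add: zcoeff_def)

text \<open>Put i = a - k, j = b - k and N = i + j + (k + 1). Then
  \<open>zcoeff (Suc a) (Suc b) (Suc k)\<close> is, up to sign, N! / (i! j! (k+1)!). Lowering one of
  the three lower entries by 1 multiplies this by that entry over N. The three lowerings are this
  lemma, \<open>zcoeff_left\<close> and \<open>zcoeff_right\<close>.\<close>

lemma zcoeff_diagonal:
  assumes "k \<le> a" "k \<le> b"
  shows "(real a + real b + 1 - real k) * zcoeff a b k =
           - (real k + 1) * zcoeff (Suc a) (Suc b) (Suc k)"
proof -
  obtain i j where "a = k + i" "b = k + j"
    using assms le_Suc_ex by blast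
  moreover have "1 + real k \<noteq> 0" by linarith
  ultimately show ?thesis
    by (simp add: zcoeff_def divide_simps fact_Suc) (simp add: algebra_simps)
qed

lemma zcoeff_left:
  assumes "k \<le> a" "k \<le> b"
  shows "(real a + real b + 1 - real k) * zcoeff a (Suc b) (Suc k) =
           (real a - real k) * zcoeff (Suc a) (Suc b) (Suc k)"
proof -
  obtain i j where ij: "a = k + i" "b = k + j"
    using assms le_Suc_ex by blast
  show ?thesis
  \<comment> \<open>For i = 0 the left coefficient has index k + 1 > a and is 0 by default, while
    the factor a - k vanishes on the right.\<close>
  proof (cases i)
    case 0
    then show ?thesis by (simp add: zcoeff_def ij)
  next
    case (Suc l)
    then show ?thesis by (simp add: zcoeff_def ij divide_simps fact_Suc)
  qed
qed

lemma zcoeff_commute: "zcoeff a b k = zcoeff b a k"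
  by (simp add: zcoeff_def add.commute mult_ac)

lemma zcoeff_right:
  assumes "k \<le> a" "k \<le> b"
  shows "(real a + real b + 1 - real k) * zcoeff (Suc a) b (Suc k) =
           (real b - real k) * zcoeff (Suc a) (Suc b) (Suc k)"
  using zcoeff_left[OF assms(2,1)] by (simp add: zcoeff_commute add.commute)

lemma zcoeff_pascal_0:
  "zcoeff (Suc a) (Suc b) 0 = zcoeff a (Suc b) 0 + zcoeff (Suc a) b 0"
  by (simp add: divide_simps fact_Suc) (simp add: algebra_simps)

text \<open>After multiplication by N all four terms are multiples of one coefficient, and the claim
  becomes N - (k + 1) = i + j.\<close>

lemma zcoeff_pascal:
  "zcoeff (Suc a) (Suc b) (Suc k) + zcoeff a b k =
     zcoeff a (Suc b) (Suc k) + zcoeff (Suc a) b (Suc k)"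
proof (cases "k \<le> a \<and> k \<le> b")
  case True
  then have le: "k \<le> a" "k \<le> b" by auto
  define N where "N = real a + real b + 1 - real k"
  have "N \<noteq> 0" using le by (simp add: N_def)
  have "N * (zcoeff (Suc a) (Suc b) (Suc k) + zcoeff a b k) =
          N * (zcoeff a (Suc b) (Suc k) + zcoeff (Suc a) b (Suc k))"
    unfolding distrib_left N_def zcoeff_diagonal[OF le] zcoeff_left[OF le] zcoeff_right[OF le]
    by (simp add: algebra_simps)
  then show ?thesis using \<open>N \<noteq> 0\<close> by simp
qed (auto simp: zcoeff_def)

text \<open>As for Pascal's rule, but the sign of the diagonal term is reversed: N + (k + 1) = a + b
  + 2 gives the constant, and the exponent a + b - 2k is i + j.\<close>

lemma zcoeff_deriv:
  "real (a + b - 2 * k) * (zcoeff (Suc a) (Suc b) (Suc k) - zcoeff a b k) =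
     (real a + real b + 2) * (zcoeff a (Suc b) (Suc k) + zcoeff (Suc a) b (Suc k))"
proof (cases "k \<le> a \<and> k \<le> b")
  case True
  then have le: "k \<le> a" "k \<le> b" by auto
  define N c where "N = real a + real b + 1 - real k" and "c = zcoeff (Suc a) (Suc b) (Suc k)"
  have "N \<noteq> 0" using le by (simp add: N_def)
  have exponent: "real (a + b - 2 * k) = real a + real b - 2 * real k"
    using le by (simp add: of_nat_diff)
  have "N * (real (a + b - 2 * k) * (c - zcoeff a b k)) =
          real (a + b - 2 * k) * (N * c - N * zcoeff a b k)"
    by (simp add: algebra_simps)
  also have "\<dots> = (real a + real b + 2) * (N * zcoeff a (Suc b) (Suc k) + N * zcoeff (Suc a) b (Suc k))"
    unfolding exponent N_def zcoeff_diagonal[OF le] zcoeff_left[OF le] zcoeff_right[OF le]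
      c_def[symmetric]
    by (simp add: algebra_simps)
  also have "\<dots> = N * ((real a + real b + 2) * (zcoeff a (Suc b) (Suc k) + zcoeff (Suc a) b (Suc k)))"
    by (simp add: algebra_simps)
  finally show ?thesis using \<open>N \<noteq> 0\<close> by (simp add: c_def)
qed (auto simp: zcoeff_def)

text \<open>In this and the next two expansions the top power is split off, so that the remaining
  sums all run over k <= b and can be compared term by term.\<close>

lemma zpoly_Suc_Suc:
  "zpoly (Suc a) (Suc b) r =
     zcoeff (Suc a) (Suc b) 0 * r ^ (a + b + 2)
       + (\<Sum>k\<le>b. zcoeff (Suc a) (Suc b) (Suc k) * r ^ (a + b - 2 * k))"
  by (simp add: zpoly_def sum.atMost_Suc_shift del: sum.atMost_Suc zcoeff_0)

lemma zpoly_Suc_right: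
  "zpoly a (Suc b) r =
     zcoeff a (Suc b) 0 * r ^ (a + b + 1)
       + (\<Sum>k\<le>b. zcoeff a (Suc b) (Suc k) * r ^ (a + b - 2 * k - 1))"
  by (simp add: zpoly_def sum.atMost_Suc_shift del: sum.atMost_Suc zcoeff_0)

lemma zpoly_Suc_left:
  "zpoly (Suc a) b r =
     zcoeff (Suc a) b 0 * r ^ (a + b + 1)
       + (\<Sum>k\<le>b. zcoeff (Suc a) b (Suc k) * r ^ (a + b - 2 * k - 1))"
  by (subst zpoly_extend[of _ "Suc b"])
     (simp_all add: sum.atMost_Suc_shift del: sum.atMost_Suc zcoeff_0)

lemma zpoly_rec:
  "zpoly (Suc a) (Suc b) r + zpoly a b r = r * (zpoly a (Suc b) r + zpoly (Suc a) b r)"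
proof -
  have step: "zcoeff (Suc a) (Suc b) (Suc k) * r ^ (a + b - 2 * k) + zcoeff a b k * r ^ (a + b - 2 * k) =
      r * (zcoeff a (Suc b) (Suc k) * r ^ (a + b - 2 * k - 1)
         + zcoeff (Suc a) b (Suc k) * r ^ (a + b - 2 * k - 1))" for k
  \<comment> \<open>A factor r can be moved into the truncated power only if 2k < a + b. Otherwise k
    < a, k <= b and k <= a, k < b both fail, so the right side is 0 and Pascal's rule makes the left
    side cancel.\<close>
  proof (cases "2 * k < a + b")
    case True
    then have "r ^ (a + b - 2 * k) = r * r ^ (a + b - 2 * k - 1)"
      by (metis power_eq_if zero_less_diff less_numeral_extra(3))
    then have "?thesis \<longleftrightarrow>
        (zcoeff (Suc a) (Suc b) (Suc k) + zcoeff a b k) * (r * r ^ (a + b - 2 * k - 1)) =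
        (zcoeff a (Suc b) (Suc k) + zcoeff (Suc a) b (Suc k)) * (r * r ^ (a + b - 2 * k - 1))"
      by (simp only:) (simp add: algebra_simps)
    then show ?thesis by (simp only: zcoeff_pascal)
  next
    case False
    then have "zcoeff a (Suc b) (Suc k) = 0" "zcoeff (Suc a) b (Suc k) = 0"
      by (auto simp: zcoeff_def)
    with zcoeff_pascal[of a b k] show ?thesis
      by (simp add: ring_distribs(2)[symmetric])
  qed
  have "zpoly (Suc a) (Suc b) r + zpoly a b r =
      zcoeff (Suc a) (Suc b) 0 * r ^ (a + b + 2)
      + (\<Sum>k\<le>b. zcoeff (Suc a) (Suc b) (Suc k) * r ^ (a + b - 2 * k)
             + zcoeff a b k * r ^ (a + b - 2 * k))"
    unfolding zpoly_Suc_Suc sum.distrib by (simp add: zpoly_def)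
  also have "\<dots> = r * (zpoly a (Suc b) r + zpoly (Suc a) b r)"
    unfolding step zpoly_Suc_right zpoly_Suc_left zcoeff_pascal_0 sum_distrib_left[symmetric]
      sum.distrib
    by (simp add: algebra_simps del: zcoeff_0)
  finally show ?thesis .
qed

lemma zpoly_has_derivative:
  "((\<lambda>r. zpoly (Suc a) (Suc b) r - zpoly a b r) has_real_derivative
     (real a + real b + 2) * (zpoly a (Suc b) r + zpoly (Suc a) b r)) (at r within A)"
proof -
  have eq: "zpoly (Suc a) (Suc b) x - zpoly a b x =
      zcoeff (Suc a) (Suc b) 0 * x ^ (a + b + 2)
      + (\<Sum>k\<le>b. (zcoeff (Suc a) (Suc b) (Suc k) - zcoeff a b k) * x ^ (a + b - 2 * k))" for x
    unfolding zpoly_Suc_Suc by (simp add: zpoly_def left_diff_distrib sum_subtractf)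
  have pow: "((\<lambda>r. r ^ k) has_real_derivative real k * r ^ (k - 1)) (at r within A)" for k
    using DERIV_pow[of k r A] by simp
  have "((\<lambda>r. zpoly (Suc a) (Suc b) r - zpoly a b r) has_real_derivative
      zcoeff (Suc a) (Suc b) 0 * (real (a + b + 2) * r ^ (a + b + 1))
      + (\<Sum>k\<le>b. (zcoeff (Suc a) (Suc b) (Suc k) - zcoeff a b k)
             * (real (a + b - 2 * k) * r ^ (a + b - 2 * k - 1)))) (at r within A)"
    unfolding eq
    using pow[of "a + b + 2"] by (intro DERIV_add DERIV_cmult DERIV_sum pow) (simp del: power_Suc)
  also have "(\<lambda>k. (zcoeff (Suc a) (Suc b) (Suc k) - zcoeff a b k)
             * (real (a + b - 2 * k) * r ^ (a + b - 2 * k - 1))) =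
      (\<lambda>k. (real a + real b + 2) * (zcoeff a (Suc b) (Suc k) * r ^ (a + b - 2 * k - 1)
             + zcoeff (Suc a) b (Suc k) * r ^ (a + b - 2 * k - 1)))"
  proof
    fix k
    show "(zcoeff (Suc a) (Suc b) (Suc k) - zcoeff a b k)
             * (real (a + b - 2 * k) * r ^ (a + b - 2 * k - 1)) =
        (real a + real b + 2) * (zcoeff a (Suc b) (Suc k) * r ^ (a + b - 2 * k - 1)
             + zcoeff (Suc a) b (Suc k) * r ^ (a + b - 2 * k - 1))"
      \<comment> \<open>No case split on the exponent is needed here: the same truncated power
        occurs on both sides.\<close>
      using arg_cong[OF zcoeff_deriv[of a b k], of "\<lambda>x. x * r ^ (a + b - 2 * k - 1)"]
      by (simp add: algebra_simps)
  qed
  also have "zcoeff (Suc a) (Suc b) 0 * (real (a + b + 2) * r ^ (a + b + 1)) + sum \<dots> {..b} =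
      (real a + real b + 2) * (zpoly a (Suc b) r + zpoly (Suc a) b r)"
    unfolding zpoly_Suc_right zpoly_Suc_left zcoeff_pascal_0 sum_distrib_left[symmetric]
      sum.distrib
    by (simp add: algebra_simps del: zcoeff_0)
  finally show ?thesis .
qed

lemma continuous_on_zpoly [continuous_intros]: "continuous_on A (zpoly a b)"
  unfolding zpoly_def by (intro continuous_intros)

lemma integrable_zpoly:
  "zpoly a b integrable_on {x..y}" "(\<lambda>t. t * zpoly a b t) integrable_on {x..y}"
  by (auto intro!: integrable_continuous_real continuous_intros)

text \<open>For b < a the antiderivative vanishes at 0. For a = b it would not, since
  \<open>zpoly b b 0\<close> is (-1)^b.\<close>

lemma integral_zpoly_add:
  assumes "b < a" "0 \<le> r"
  shows "integral {0..r} (zpoly a (Suc b)) + integral {0..r} (zpoly (Suc a) b) =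
           1 / (real a + real b + 2) * (zpoly (Suc a) (Suc b) r - zpoly a b r)"
proof -
  have "((\<lambda>t. (real a + real b + 2) * (zpoly a (Suc b) t + zpoly (Suc a) b t)) has_integral
      zpoly (Suc a) (Suc b) r - zpoly a b r - (zpoly (Suc a) (Suc b) 0 - zpoly a b 0)) {0..r}"
    using assms zpoly_has_derivative
    by (intro fundamental_theorem_of_calculus)
       (auto simp: has_real_derivative_iff_has_vector_derivative[symmetric])
  then have "(real a + real b + 2) * integral {0..r} (\<lambda>t. zpoly a (Suc b) t + zpoly (Suc a) b t) =
      zpoly (Suc a) (Suc b) r - zpoly a b r"
    using assms by (simp add: has_integral_iff zpoly_at_0)
  moreover have "real a + real b + 2 \<noteq> 0"
    by (simp add: add_nonneg_eq_0_iff)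
  ultimately show ?thesis
    by (simp add: integral_add integrable_zpoly field_simps)
qed

lemma integral_mult_zpoly_add:
  "integral {0..r} (\<lambda>t. t * zpoly a (Suc b) t) + integral {0..r} (\<lambda>t. t * zpoly (Suc a) b t) =
     integral {0..r} (zpoly (Suc a) (Suc b)) + integral {0..r} (zpoly a b)"
  by (simp add: integral_add[symmetric] integrable_zpoly zpoly_rec distrib_left)

lemma integral_power:
  assumes "0 \<le> (r::real)"
  shows "integral {0..r} (\<lambda>t. t ^ n) = r ^ (n + 1) / (real n + 1)"
proof -
  have "((\<lambda>t. t ^ (n + 1) / (real n + 1)) has_real_derivative t ^ n) (at t within {0..r})" for t
    by (rule DERIV_cong[OF DERIV_cdivide[OF DERIV_pow]]) (simp add: field_simps)
  then have "((\<lambda>t. t ^ n) has_integral r ^ (n + 1) / (real n + 1) - 0 ^ (n + 1) / (real n + 1)) {0..r}"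
    using assms
    by (intro fundamental_theorem_of_calculus)
       (auto simp: has_real_derivative_iff_has_vector_derivative[symmetric])
  then show ?thesis by (simp add: has_integral_iff)
qed

lemma zernike_R_diagonal: "zernike_R n n r = r ^ n"
  using zernike_R_eq_zpoly[of 0 n r] by simp

theorem proposition1:
  fixes n m :: nat and r :: real
  assumes "2 \<le> n" and "2 \<le> m" and "m \<le> n" and "even (n - m)"
    and "r \<in> {0..1}"
  shows "zernike_R n m r =
           r * (zernike_R (n - 1) (nat \<bar>int m - 1\<bar>) r + zernike_R (n - 1) (m + 1) r)
             - zernike_R (n - 2) m r
       \<and> zernike_S n (m - 2) r =
           1 / (real n + 1) * (zernike_R (n + 1) (m - 1) r - zernike_R (n - 1) (m - 1) r)
             - zernike_S n m r
       \<and> zernike_Q n (m - 2) r =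
           zernike_S (n + 1) (m - 1) r + zernike_S (n - 1) (m - 1) r - zernike_Q n m r
       \<and> (m = n \<longrightarrow>
            zernike_R n n r = r ^ n
          \<and> zernike_S n n r = r ^ (n + 1) / (real n + 1)
          \<and> zernike_Q n n r = r ^ (n + 2) / (real n + 2))"
proof -
  have r: "0 \<le> r" using assms(5) by simp
  obtain b where b: "n = m + 2 * b"
    using assms(3,4) by (metis evenE le_add_diff_inverse)
  \<comment> \<open>With this choice the four polynomials in the S and Q relations sit at the
    corners of the unit square with lowest corner (c, b), and b < c says m >= 2.\<close>
  define c where "c = m + b - 1"
  have c: "n = Suc c + b" "m = Suc c - b" "b < c" "b \<le> c"
    using b assms(2) by (auto simp: c_def)
  have n_real: "real n = real c + real b + 1"
    using c(1) by simp
  have R: "zernike_R n m = zpoly (Suc c) b"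
    "zernike_R (n - 1) (m - 1) = zpoly c b"
    "zernike_R n (m - 2) = zpoly c (Suc b)"
    "zernike_R (n + 1) (m - 1) = zpoly (Suc c) (Suc b)"
    using c zernike_R_eq_zpoly[of b "Suc c"] zernike_R_eq_zpoly[of b c]
      zernike_R_eq_zpoly[of "Suc b" c] zernike_R_eq_zpoly[of "Suc b" "Suc c"]
    by (auto simp: fun_eq_iff Suc_diff_le)
  have abs_m: "nat \<bar>int m - 1\<bar> = m - 1"
    using assms(2) by auto
  have rec: "zernike_R n m r =
      r * (zernike_R (n - 1) (m - 1) r + zernike_R (n - 1) (m + 1) r) - zernike_R (n - 2) m r"
  \<comment> \<open>The recurrence for R uses the square one step lower, at (c, b - 1). For b = 0,
    that is m = n, this square does not exist; there the terms with upper index m + 1 > n - 1 and m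
    > n - 2 are 0 by convention.\<close>
  proof (cases b)
    case 0
    then have "m = n" using b by simp
    moreover have "r ^ n = r * r ^ (n - 1)"
      using assms(1) by (metis power_eq_if not_numeral_le_zero)
    ultimately show ?thesis using assms(1)
      by (simp add: zernike_R_diagonal) (simp add: zernike_R_def)
  next
    case (Suc d)
    have "zernike_R (n - 1) (m + 1) = zpoly (Suc c) d" "zernike_R (n - 2) m = zpoly c d"
      using c Suc zernike_R_eq_zpoly[of d "Suc c"] zernike_R_eq_zpoly[of d c]
      by (auto simp: fun_eq_iff Suc_diff_le Suc_diff_Suc)
    then show ?thesis
      using zpoly_rec[of c d r] R(1,2) by (simp add: Suc del: One_nat_def)
  qed
  have "zernike_S n (m - 2) r =
      1 / (real n + 1) * (zernike_R (n + 1) (m - 1) r - zernike_R (n - 1) (m - 1) r)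
        - zernike_S n m r"
    using integral_zpoly_add[OF \<open>b < c\<close> r] n_real unfolding zernike_S_def R
    by (simp add: algebra_simps)
  moreover have "zernike_Q n (m - 2) r =
      zernike_S (n + 1) (m - 1) r + zernike_S (n - 1) (m - 1) r - zernike_Q n m r"
    using integral_mult_zpoly_add[of r c b] unfolding zernike_Q_def zernike_S_def R by simp
  moreover have "zernike_S n n r = r ^ (n + 1) / (real n + 1)"
    using integral_power[OF r, of n] by (simp add: zernike_S_def zernike_R_diagonal)
  moreover have "zernike_Q n n r = r ^ (n + 2) / (real n + 2)"
    using integral_power[OF r, of "Suc n"]
    by (simp add: zernike_Q_def zernike_R_diagonal add.commute)
  ultimately show ?thesis
    using rec zernike_R_diagonal[of n r] unfolding abs_m by blast
qed

end
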